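(* Let $d\in\mathbb{N}$, $d\ge 1$, let $0<\theta<1$, and let $\mu,\lambda$ be constants with $\mu>0$ and $\lambda+\mu>0$. Let $a,b$ be constants with $0<\frac{a}{2^d}<a<\frac{b}{2^d}<b$, and suppose that the (non-monotone) pressure function $p$ satisfies $$p\left(\frac{a}{t^d}\right)=p\left(\frac{b}{t^d}\right)\qquad\text{for all } t\in[1,2].$$ Define, for $t\in[1,2]$ and $y\in\mathbb{R}^d$, $$\rho(t,y)=\begin{cases}\dfrac{a}{t^d}, & kt<|y|<(k+\theta)t,\\[6pt] \dfrac{b}{t^d}, & (k+\theta)t<|y|<(k+1)t,\end{cases}\qquad k\in\{0,1,2,\dots\},\qquad u(t,y)=\frac{y}{t}.$$ Then $(\rho,u)$ is a weak solution, for $t\in[1,2]$ and $y\in\mathbb{R}^d$, of the compressible Navier-Stokes system $$\begin{aligned}\partial_t\rho+\operatorname{div}(\rho u)&=0,\\ \partial_t(\rho u)+\operatorname{div}(\rho u\otimes u)+\nabla p(\rho)&=\operatorname{div}\Big(\mu(\nabla u+\nabla u^T)+\lambda(\operatorname{div}u)\,I\Big).\end{aligned}$$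
   Context: Here $\rho$ is the density, $u$ the velocity (with values in $\mathbb{R}^d$), $I$ the $d\times d$ identity matrix, and $p:(0,\infty)\to\mathbb{R}$ is a given continuous function of the density. The function $\rho$ is defined for almost every $(t,y)$ (its values on the interfaces $|y|=kt$ and $|y|=(k+\theta)t$ are irrelevant). "Weak solution" means that both equations hold in the sense of distributions on $(1,2)\times\mathbb{R}^d$. *)

theory Defs
  imports "HOL-Analysis.Analysis"
begin

section \<open>Distributions\<close>

primrec C_k :: "nat \<Rightarrow> ('a::real_normed_vector \<Rightarrow> real) \<Rightarrow> bool" where
  "C_k 0 f \<longleftrightarrow> continuous_on UNIV f"
| "C_k (Suc k) f \<longleftrightarrow> (\<forall>x. f differentiable at x) \<and>
     (\<forall>v. C_k k (\<lambda>x. frechet_derivative f (at x) v))"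

definition test_functions :: "'a::euclidean_space set \<Rightarrow> ('a \<Rightarrow> real) set" where
  "test_functions \<Omega> = {\<phi>. (\<forall>k. C_k k \<phi>) \<and>
     compact (closure {x. \<phi> x \<noteq> 0}) \<and> closure {x. \<phi> x \<noteq> 0} \<subseteq> \<Omega>}"

text \<open>A distribution on \<open>\<Omega>\<close> is represented by its action on functions; only its values on
  \<open>test_functions \<Omega>\<close> are meaningful, so identities between distributions are to be
  stated for arguments in that set.\<close>

type_synonym 'a distribution = "('a \<Rightarrow> real) \<Rightarrow> real"

definition locally_integrable :: "'a::euclidean_space set \<Rightarrow> ('a \<Rightarrow> real) \<Rightarrow> bool" where
  "locally_integrable \<Omega> f \<longleftrightarrow> (\<forall>K. compact K \<and> K \<subseteq> \<Omega> \<longrightarrow> f absolutely_integrable_on K)"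

definition dist_of :: "'a::euclidean_space set \<Rightarrow> ('a \<Rightarrow> real) \<Rightarrow> 'a distribution" where
  "dist_of \<Omega> f = (\<lambda>\<phi>. LINT x:\<Omega>|lebesgue. f x * \<phi> x)"

definition dist_deriv :: "'a::euclidean_space \<Rightarrow> 'a distribution \<Rightarrow> 'a distribution" where
  "dist_deriv v T = (\<lambda>\<phi>. - T (\<lambda>x. frechet_derivative \<phi> (at x) v))"

section \<open>The compressible Navier-Stokes system\<close>

definition dt :: "(real \<times> (real^'d)) distribution \<Rightarrow> (real \<times> (real^'d)) distribution" where
  "dt T = dist_deriv (1, 0) T"

definition dx :: "'d::finite \<Rightarrow> (real \<times> (real^'d)) distribution \<Rightarrow> (real \<times> (real^'d)) distribution" where
  "dx j T = dist_deriv (0, axis j 1) T"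

definition dist_div :: "('d::finite \<Rightarrow> (real \<times> (real^'d)) distribution) \<Rightarrow> (real \<times> (real^'d)) distribution" where
  "dist_div F = (\<lambda>\<phi>. \<Sum>j\<in>UNIV. dx j (F j) \<phi>)"

text \<open>The \<open>(i, j)\<close> entry of \<open>\<mu> (\<nabla>u + \<nabla>u\<^sup>T) + \<lambda> (div u) I\<close>, the derivatives of
  \<open>u\<close> being taken in the sense of distributions.\<close>

definition viscous_stress ::
  "(real \<times> (real^'d)) set \<Rightarrow> real \<Rightarrow> real \<Rightarrow> (real \<times> (real^'d) \<Rightarrow> real^'d) \<Rightarrow>
   'd::finite \<Rightarrow> 'd \<Rightarrow> (real \<times> (real^'d)) distribution" where
  "viscous_stress \<Omega> \<mu> lam u i j = (\<lambda>\<phi>.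
     \<mu> * (dx j (dist_of \<Omega> (\<lambda>x. u x $ i)) \<phi> + dx i (dist_of \<Omega> (\<lambda>x. u x $ j)) \<phi>)
     + lam * dist_div (\<lambda>k. dist_of \<Omega> (\<lambda>x. u x $ k)) \<phi> * (mat 1 :: real^'d^'d) $ i $ j)"

text \<open>The pressure \<open>p\<close> only has a meaning on \<open>(0, \<infinity>)\<close>; positivity of \<open>\<rho>\<close> almost
  everywhere ensures that no other values of \<open>p\<close> enter. Local integrability of all the
  nonlinear terms makes them distributions (otherwise the integral in \<open>dist_of\<close> could take
  its default value 0). The divergence of a matrix field is taken row by row.\<close>

definition weak_solution_NS ::
  "(real \<times> (real^'d::finite)) set \<Rightarrow> real \<Rightarrow> real \<Rightarrow> (real \<Rightarrow> real) \<Rightarrow>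
   (real \<times> (real^'d) \<Rightarrow> real) \<Rightarrow> (real \<times> (real^'d) \<Rightarrow> real^'d) \<Rightarrow> bool" where
  "weak_solution_NS \<Omega> \<mu> lam p \<rho> u \<longleftrightarrow>
     (AE x in lebesgue. x \<in> \<Omega> \<longrightarrow> 0 < \<rho> x) \<and>
     locally_integrable \<Omega> \<rho> \<and>
     locally_integrable \<Omega> (\<lambda>x. p (\<rho> x)) \<and>
     (\<forall>i. locally_integrable \<Omega> (\<lambda>x. u x $ i)) \<and>
     (\<forall>i. locally_integrable \<Omega> (\<lambda>x. \<rho> x * u x $ i)) \<and>
     (\<forall>i j. locally_integrable \<Omega> (\<lambda>x. \<rho> x * u x $ i * u x $ j)) \<and>
     (\<forall>\<phi>\<in>test_functions \<Omega>.
        dt (dist_of \<Omega> \<rho>) \<phi> + dist_div (\<lambda>j. dist_of \<Omega> (\<lambda>x. \<rho> x * u x $ j)) \<phi> = 0) \<and>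
     (\<forall>i. \<forall>\<phi>\<in>test_functions \<Omega>.
        dt (dist_of \<Omega> (\<lambda>x. \<rho> x * u x $ i)) \<phi>
        + dist_div (\<lambda>j. dist_of \<Omega> (\<lambda>x. \<rho> x * u x $ i * u x $ j)) \<phi>
        + dx i (dist_of \<Omega> (\<lambda>x. p (\<rho> x))) \<phi>
        = dist_div (viscous_stress \<Omega> \<mu> lam u i) \<phi>)"

end

theory Submission
  imports Defs
begin

text \<open>Up to a null set, \<open>\<rho>\<close> is a function of \<open>y / t\<close> divided by \<open>t ^ d\<close>, so \<open>\<rho>\<close> and
  \<open>\<rho> u\<^sub>i\<close> are homogeneous of degree \<open>-d\<close> in \<open>x = (t, y)\<close>. The transport operator
  \<open>\<partial>\<^sub>t + u \<cdot> \<nabla>\<close> is \<open>1 / t\<close> times the Euler operator \<open>x \<cdot> \<nabla>\<close>, and \<open>\<rho> / t\<close> and \<open>\<rho> u\<^sub>i / t\<close> have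
  degree minus the dimension of space-time; hence their integrals against \<open>\<phi> (c x)\<close> do not depend
  on \<open>c\<close>, and differentiating at \<open>c = 1\<close> gives both transport identities. The pressure is a
  function of \<open>t\<close> alone, and \<open>u\<close> is linear in \<open>y\<close>, so the remaining terms vanish in the same way
  by invariance under spatial translations.\<close>

section \<open>Differentiating invariant integrals along a flow\<close>

lemma bounded_image_normE:
  assumes "bounded (f ` S)"
  obtains B where "\<And>x. x \<in> S \<Longrightarrow> norm (f x) \<le> B"
  using assms unfolding bounded_iff by blast

lemma integrable_bounded_times_compact_support:
  fixes w f :: "'a::euclidean_space \<Rightarrow> real"
  assumes w: "w \<in> borel_measurable borel" "bounded (w ` K)" and K: "compact K"
    and f: "continuous_on UNIV f" "\<And>x. x \<notin> K \<Longrightarrow> f x = 0"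
  shows "integrable lborel (\<lambda>x. w x * f x)"
proof -
  have "bounded (f ` K)"
    by (intro compact_imp_bounded compact_continuous_image K continuous_on_subset[OF f(1)] subset_UNIV)
  then obtain B where B: "\<And>x. x \<in> K \<Longrightarrow> \<bar>f x\<bar> \<le> B"
    by (rule bounded_image_normE[where f=f, unfolded real_norm_def]) blast
  obtain A where A: "\<And>x. x \<in> K \<Longrightarrow> \<bar>w x\<bar> \<le> A"
    using w(2) by (rule bounded_image_normE[where f=w, unfolded real_norm_def]) blast
  show ?thesis
  proof (rule Bochner_Integration.integrable_bound)
    show "integrable lborel (\<lambda>x. indicator K x * (A * B))"
      using emeasure_bounded_finite[OF compact_imp_bounded[OF K]] borel_compact[OF K]
      by (intro integrable_mult_left integrable_real_indicator) simp_all
    show "(\<lambda>x. w x * f x) \<in> borel_measurable lborel"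
      using w(1) borel_measurable_continuous_onI[OF f(1)] by simp
    show "AE x in lborel. norm (w x * f x) \<le> norm (indicator K x * (A * B))"
    proof (rule AE_I2)
      fix x show "norm (w x * f x) \<le> norm (indicator K x * (A * B))"
      proof (cases "x \<in> K")
        case True
        have "\<bar>w x\<bar> * \<bar>f x\<bar> \<le> A * B"
          using A[OF True] B[OF True] by (intro mult_mono) auto
        then show ?thesis using True abs_ge_self[of "A * B"] by (simp add: abs_mult)
      qed (simp add: f(2))
    qed
  qed
qed

text \<open>Differentiates the invariance hypothesis at \<open>s = 0\<close>; the cases of interest are
  \<open>V x = v\<close> (translations) and \<open>V x = x\<close> (dilations).\<close>

lemma flow_derivative_integral_zero:
  fixes w h :: "'a::euclidean_space \<Rightarrow> real" and V :: "'a \<Rightarrow> 'a"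
  assumes diff: "\<And>x. h differentiable at x"
    and lip: "L-lipschitz_on UNIV h"
    and C: "compact C" and w: "w \<in> borel_measurable borel" "bounded (w ` C)"
    and V: "continuous_on UNIV V"
    and supp: "\<And>x s. 0 \<le> s \<Longrightarrow> s \<le> 1 \<Longrightarrow> x \<notin> C \<Longrightarrow> h (x + s *\<^sub>R V x) = 0"
    and inv: "\<And>s. 0 < s \<Longrightarrow> s \<le> 1 \<Longrightarrow>
      (LINT x|lborel. w x * h (x + s *\<^sub>R V x)) = (LINT x|lborel. w x * h x)"
  shows "(LINT x|lborel. w x * frechet_derivative h (at x) (V x)) = 0"
proof -
  have h: "continuous_on UNIV h"
    using lip lipschitz_on_continuous_on by blast
  have hs: "continuous_on UNIV (\<lambda>x. h (x + s *\<^sub>R V x))" for s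
    by (intro continuous_on_compose2[OF h] continuous_intros V) auto
  define s where "s n = 1 / real (Suc n)" for n
  have s: "0 < s n" "s n \<le> 1" for n
    by (auto simp: s_def)
  have s0: "s \<longlonglongrightarrow> 0"
    unfolding s_def by (rule LIMSEQ_Suc, rule lim_1_over_n)
  \<comment> \<open>Weighted difference quotients along the straight path in direction
    \<open>V x\<close>. By \<open>inv\<close> each has integral zero, so it remains to pass to the
    limit under the integral sign.\<close>
  define F where "F n x = w x * ((h (x + s n *\<^sub>R V x) - h x) / s n)" for n x
  have supp0: "h x = 0" if "x \<notin> C" for x
    using supp[OF order_refl zero_le_one that] by simp
  have int1: "integrable lborel (\<lambda>x. w x * h (x + s n *\<^sub>R V x))" for n
    using supp[OF less_imp_le[OF s(1)] s(2)]
    by (rule integrable_bounded_times_compact_support[OF w C hs])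
  have int0: "integrable lborel (\<lambda>x. w x * h x)"
    using supp0 by (rule integrable_bounded_times_compact_support[OF w C h])
  have F0: "(LINT x|lborel. F n x) = 0" for n
  proof -
    have "(LINT x|lborel. F n x)
        = (LINT x|lborel. (w x * h (x + s n *\<^sub>R V x) - w x * h x) / s n)"
      by (simp add: F_def right_diff_distrib)
    also have "\<dots> = 0"
      using int1[of n] int0 inv[OF s] by simp
    finally show ?thesis .
  qed
  have Fm: "F n \<in> borel_measurable lborel" for n
    unfolding F_def using w(1) borel_measurable_continuous_onI[OF h] borel_measurable_continuous_onI[OF hs]
    by (auto intro!: borel_measurable_times borel_measurable_divide borel_measurable_diff)
  have lim: "(\<lambda>n. F n x) \<longlonglongrightarrow> w x * frechet_derivative h (at x) (V x)" for x
  proof -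
    have g: "((\<lambda>\<sigma>. x + \<sigma> *\<^sub>R V x) has_derivative (\<lambda>\<sigma>. \<sigma> *\<^sub>R V x)) (at 0)"
      by (auto intro!: derivative_eq_intros)
    have "(h has_derivative frechet_derivative h (at x)) (at (x + 0 *\<^sub>R V x))"
      using diff frechet_derivative_works by auto
    from diff_chain_at[OF g this]
    have "((\<lambda>\<sigma>. h (x + \<sigma> *\<^sub>R V x)) has_derivative (\<lambda>\<sigma>. frechet_derivative h (at x) (\<sigma> *\<^sub>R V x))) (at 0)"
      by (simp add: o_def)
    moreover have "(\<lambda>\<sigma>. frechet_derivative h (at x) (\<sigma> *\<^sub>R V x))
        = (*) (frechet_derivative h (at x) (V x))"
      using linear_frechet_derivative[OF diff[of x]] by (auto simp: linear_cmul mult.commute)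
    ultimately have "((\<lambda>\<sigma>. h (x + \<sigma> *\<^sub>R V x)) has_field_derivative frechet_derivative h (at x) (V x)) (at 0)"
      by (simp add: has_field_derivative_def)
    then have "((\<lambda>\<sigma>. (h (x + \<sigma> *\<^sub>R V x) - h x) / \<sigma>) \<longlongrightarrow> frechet_derivative h (at x) (V x)) (at 0)"
      by (simp add: DERIV_def)
    moreover have "filterlim s (at 0) sequentially"
      using s0 s(1) by (auto simp: filterlim_at less_le intro!: always_eventually)
    ultimately have "(\<lambda>n. (h (x + s n *\<^sub>R V x) - h x) / s n) \<longlonglongrightarrow> frechet_derivative h (at x) (V x)"
      by (rule filterlim_compose)
    then show ?thesis
      unfolding F_def by (intro tendsto_intros)
  qed
  have L: "0 \<le> L" using lip by (rule lipschitz_on_nonneg)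
  obtain A where A: "\<And>x. x \<in> C \<Longrightarrow> \<bar>w x\<bar> \<le> A"
    using w(2) by (rule bounded_image_normE[where f=w, unfolded real_norm_def]) blast
  have "bounded (V ` C)"
    by (intro compact_imp_bounded compact_continuous_image C continuous_on_subset[OF V] subset_UNIV)
  then obtain B where B: "\<And>x. x \<in> C \<Longrightarrow> norm (V x) \<le> B"
    by (rule bounded_image_normE) blast
  \<comment> \<open>The Lipschitz constant bounds the quotient by \<open>L * norm (V x)\<close>
    uniformly in \<open>n\<close>. With all supports inside \<open>C\<close>, this gives one
    integrable dominating function for the whole sequence.\<close>
  have bnd: "norm (F n x) \<le> indicator C x * (A * (L * B))" for n x
  proof (cases "x \<in> C")
    case True
    have "\<bar>h (x + s n *\<^sub>R V x) - h x\<bar> \<le> L * norm (s n *\<^sub>R V x)"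
      using lipschitz_onD[OF lip, of "x + s n *\<^sub>R V x" x] by (simp add: dist_norm)
    then have "\<bar>h (x + s n *\<^sub>R V x) - h x\<bar> / s n \<le> L * norm (V x)"
      using s[of n] by (simp add: field_simps)
    also have "\<dots> \<le> L * B" using B[OF True] L by (rule mult_left_mono)
    finally have "\<bar>w x\<bar> * (\<bar>h (x + s n *\<^sub>R V x) - h x\<bar> / s n) \<le> A * (L * B)"
      using A[OF True] s[of n] by (intro mult_mono) auto
    then show ?thesis
      using True s[of n] by (simp add: F_def abs_mult abs_divide)
  next
    case False
    then show ?thesis
      using supp[OF less_imp_le[OF s(1)] s(2) False] supp0[OF False] by (simp add: F_def)
  qed
  have "(\<lambda>n. LINT x|lborel. F n x) \<longlonglongrightarrow> (LINT x|lborel. w x * frechet_derivative h (at x) (V x))"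
  proof (rule integral_dominated_convergence)
    show "(\<lambda>x. w x * frechet_derivative h (at x) (V x)) \<in> borel_measurable lborel"
      using lim Fm by (rule borel_measurable_LIMSEQ_real)
    show "integrable lborel (\<lambda>x. indicator C x * (A * (L * B)))"
      using emeasure_bounded_finite[OF compact_imp_bounded[OF C]] borel_compact[OF C]
      by (intro integrable_mult_left integrable_real_indicator) simp_all
  qed (use lim Fm bnd in auto)
  then show ?thesis
    using F0 LIMSEQ_unique[OF tendsto_const] by (simp add: tendsto_const_iff)
qed

section \<open>Translation and dilation identities for compactly supported C^1 functions\<close>

lemma frechet_derivative_eq_0_outside_support:
  fixes f :: "'a::real_normed_vector \<Rightarrow> real"
  assumes "x \<notin> closure {x. f x \<noteq> 0}"
  shows "frechet_derivative f (at x) v = 0"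
proof -
  have "(f has_derivative (\<lambda>_. 0)) (at x)"
  proof (rule has_derivative_transform_within_open)
    show "((\<lambda>_. 0) has_derivative (\<lambda>_. 0)) (at x)" by simp
    show "open (- closure {x. f x \<noteq> 0})" by auto
    show "x \<in> - closure {x. f x \<noteq> 0}" using assms by simp
    show "0 = f y" if "y \<in> - closure {x. f x \<noteq> 0}" for y
      using that closure_subset[of "{x. f x \<noteq> 0}"] by auto
  qed
  from frechet_derivative_at[OF this] show ?thesis by (simp add: fun_eq_iff)
qed

text \<open>\<open>C_k\<close> provides continuity of the derivative only for each fixed direction.
  Compact support makes each directional bound \<open>B v\<close> finite, summing over
  \<open>Basis\<close> bounds the operator norm, and the mean value inequality on the whole space
  gives the Lipschitz constant.\<close>

lemma C1_compact_support_lipschitz: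
  fixes f :: "'a::euclidean_space \<Rightarrow> real"
  assumes f: "C_k (Suc 0) f" and c: "compact (closure {x. f x \<noteq> 0})"
  obtains L where "L-lipschitz_on UNIV f"
proof -
  let ?K = "closure {x. f x \<noteq> 0}"
  have diff: "f differentiable at x" for x using f by simp
  define B where "B v = (SUP x. \<bar>frechet_derivative f (at x) v\<bar>)" for v
  have B: "\<bar>frechet_derivative f (at x) v\<bar> \<le> B v" for x v
  proof -
    have "continuous_on UNIV (\<lambda>x. frechet_derivative f (at x) v)" using f by simp
    then have "bounded ((\<lambda>x. frechet_derivative f (at x) v) ` ?K)"
      by (intro compact_imp_bounded compact_continuous_image c) (auto intro: continuous_on_subset)
    then obtain M where M: "\<And>x. x \<in> ?K \<Longrightarrow> \<bar>frechet_derivative f (at x) v\<bar> \<le> M"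
      by (rule bounded_image_normE[where f="\<lambda>x. frechet_derivative f (at x) v", unfolded real_norm_def]) blast
    have "\<bar>frechet_derivative f (at x) v\<bar> \<le> max 0 M" for x
      using M[of x] frechet_derivative_eq_0_outside_support[of x f v] by (cases "x \<in> ?K") auto
    then have "bdd_above (range (\<lambda>x. \<bar>frechet_derivative f (at x) v\<bar>))"
      by (intro bdd_aboveI2)
    then show ?thesis
      unfolding B_def by (rule cSUP_upper[OF UNIV_I])
  qed
  have on: "onorm (frechet_derivative f (at x)) \<le> (\<Sum>b\<in>Basis. B b)" for x
  proof (rule onorm_le)
    fix v :: 'a
    have lin: "linear (frechet_derivative f (at x))"
      using diff by (rule linear_frechet_derivative)
    have "frechet_derivative f (at x) v = frechet_derivative f (at x) (\<Sum>b\<in>Basis. (v \<bullet> b) *\<^sub>R b)"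
      unfolding euclidean_representation ..
    also have "\<dots> = (\<Sum>b\<in>Basis. (v \<bullet> b) * frechet_derivative f (at x) b)"
      unfolding linear_sum[OF lin] linear_cmul[OF lin] real_scaleR_def ..
    also have "\<bar>\<dots>\<bar> \<le> (\<Sum>b\<in>Basis. norm v * B b)"
      by (rule order_trans[OF sum_abs], rule sum_mono)
        (auto simp: abs_mult intro!: mult_mono B Basis_le_norm)
    finally show "norm (frechet_derivative f (at x) v) \<le> (\<Sum>b\<in>Basis. B b) * norm v"
      by (simp add: sum_distrib_left mult.commute)
  qed
  have "(\<Sum>b\<in>Basis. B b)-lipschitz_on UNIV f"
  proof (rule lipschitz_onI)
    show "dist (f x) (f y) \<le> (\<Sum>b\<in>Basis. B b) * dist x y" for x y
      unfolding dist_norm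
      by (rule differentiable_bound[where S=UNIV and f'="\<lambda>x. frechet_derivative f (at x)"])
        (use diff frechet_derivative_works on in auto)
    show "0 \<le> (\<Sum>b\<in>Basis. B b)"
      by (rule sum_nonneg) (meson B abs_ge_zero order_trans)
  qed
  then show thesis by (rule that)
qed

text \<open>Lebesgue measure and \<open>w\<close> are both invariant under translation along
  \<open>v\<close>, so the integral of \<open>w\<close> against a translate of \<open>h\<close> is
  constant in the shift, and its derivative vanishes. Invariance of \<open>U\<close> keeps the
  translated supports where \<open>w\<close> is locally bounded.\<close>

lemma integral_translation_derivative_eq_0:
  fixes w h :: "'a::euclidean_space \<Rightarrow> real"
  assumes h: "C_k (Suc 0) h" "compact (closure {x. h x \<noteq> 0})" "closure {x. h x \<noteq> 0} \<subseteq> U"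
    and w: "w \<in> borel_measurable borel"
      "\<And>K. compact K \<Longrightarrow> K \<subseteq> U \<Longrightarrow> bounded (w ` K)"
    and wv: "\<And>x s. w (x + s *\<^sub>R v) = w x"
    and U: "\<And>x s. x \<in> U \<Longrightarrow> x + s *\<^sub>R v \<in> U"
  shows "(LINT x|lborel. w x * frechet_derivative h (at x) v) = 0"
proof -
  let ?S = "closure {x. h x \<noteq> 0}"
  \<comment> \<open>The union of the supports of all shifted functions for \<open>s\<close> in
    [0, 1]: one compact set serving every \<open>s\<close>, being a continuous image of a compact
    product.\<close>
  define C where "C = (\<lambda>(s, y). y - s *\<^sub>R v) ` ({0..1} \<times> ?S)"
  have C: "compact C"
    unfolding C_def
    by (intro compact_continuous_image compact_Times h) (auto simp: case_prod_unfold intro!: continuous_intros)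
  have CU: "C \<subseteq> U"
    using h(3) U[of _ "- _"] by (auto simp: C_def)
  obtain L where L: "L-lipschitz_on UNIV h"
    using C1_compact_support_lipschitz[OF h(1,2)] .
  show ?thesis
  proof (rule flow_derivative_integral_zero[OF _ L C w(1) w(2)[OF C CU], where V="\<lambda>_. v"])
    show "h differentiable at x" for x using h(1) by simp
    fix s :: real
    show "h (x + s *\<^sub>R v) = 0" if "0 \<le> s" "s \<le> 1" "x \<notin> C" for x
    proof (rule ccontr)
      assume "h (x + s *\<^sub>R v) \<noteq> 0"
      then have "x + s *\<^sub>R v \<in> ?S" by (intro subsetD[OF closure_subset]) simp
      then have "(s, x + s *\<^sub>R v) \<in> {0..1} \<times> ?S" using that by simp
      moreover have "x = (x + s *\<^sub>R v) - s *\<^sub>R v" by simp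
      ultimately have "x \<in> C"
        unfolding C_def by (intro image_eqI[where x="(s, x + s *\<^sub>R v)"]) simp_all
      with that(3) show False ..
    qed
    have m: "(\<lambda>x. w x * h x) \<in> borel_measurable borel"
      using w(1) borel_measurable_continuous_onI[OF lipschitz_on_continuous_on[OF L]] by simp
    have "(LINT x|lborel. w x * h x) = (LINT x|distr lborel borel ((+) (s *\<^sub>R v)). w x * h x)"
      by (simp add: lborel_distr_plus)
    also have "\<dots> = (LINT x|lborel. w (s *\<^sub>R v + x) * h (s *\<^sub>R v + x))"
      using m by (subst integral_distr) auto
    also have "\<dots> = (LINT x|lborel. w x * h (x + s *\<^sub>R v))"
      using wv by (simp add: add.commute)
    finally show "(LINT x|lborel. w x * h (x + s *\<^sub>R v)) = (LINT x|lborel. w x * h x)" ..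
  qed auto
qed

text \<open>The Jacobian \<open>c ^ DIM('a)\<close> of the dilation by \<open>c\<close> exactly
  cancels the homogeneity factor of \<open>w\<close>, so the integral of \<open>w\<close> against
  \<open>h (c x)\<close> does not depend on \<open>c\<close>. Its derivative at \<open>c = 1\<close>
  is the Euler derivative.\<close>

lemma integral_euler_derivative_eq_0:
  fixes w h :: "'a::euclidean_space \<Rightarrow> real"
  assumes h: "C_k (Suc 0) h" "compact (closure {x. h x \<noteq> 0})" "closure {x. h x \<noteq> 0} \<subseteq> U"
    and w: "w \<in> borel_measurable borel"
      "\<And>K. compact K \<Longrightarrow> K \<subseteq> U \<Longrightarrow> bounded (w ` K)"
    and wc: "\<And>x c. 0 < c \<Longrightarrow> w (c *\<^sub>R x) = w x / c ^ DIM('a)"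
    and U: "\<And>x c. 0 < c \<Longrightarrow> x \<in> U \<Longrightarrow> c *\<^sub>R x \<in> U"
  shows "(LINT x|lborel. w x * frechet_derivative h (at x) x) = 0"
proof -
  let ?S = "closure {x. h x \<noteq> 0}"
  \<comment> \<open>Dilating the argument by \<open>1 + s\<close> shrinks the support by the
    reciprocal factor; \<open>C\<close> collects these supports for all \<open>s\<close> in
    [0, 1].\<close>
  define C where "C = (\<lambda>(s, y). (1 / (1 + s)) *\<^sub>R y) ` ({0..1} \<times> ?S)"
  have C: "compact C"
    unfolding C_def
    by (intro compact_continuous_image compact_Times h) (auto simp: case_prod_unfold intro!: continuous_intros)
  have CU: "C \<subseteq> U"
    unfolding C_def using h(3) by (auto simp: subset_iff intro!: U simp del: scaleR_left.add)
  obtain L where L: "L-lipschitz_on UNIV h"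
    using C1_compact_support_lipschitz[OF h(1,2)] .
  show ?thesis
  proof (rule flow_derivative_integral_zero[OF _ L C w(1) w(2)[OF C CU], where V="\<lambda>x. x"])
    show "h differentiable at x" for x using h(1) by simp
    fix s :: real
    have e: "x + s *\<^sub>R x = (1 + s) *\<^sub>R x" for x :: 'a by (simp add: algebra_simps)
    show "h (x + s *\<^sub>R x) = 0" if "0 \<le> s" "s \<le> 1" "x \<notin> C" for x
    proof (rule ccontr)
      assume "h (x + s *\<^sub>R x) \<noteq> 0"
      then have "x + s *\<^sub>R x \<in> ?S" by (intro subsetD[OF closure_subset]) simp
      then have "(s, x + s *\<^sub>R x) \<in> {0..1} \<times> ?S" using that by simp
      moreover have "x = (1 / (1 + s)) *\<^sub>R (x + s *\<^sub>R x)" unfolding e using that(1) by simp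
      ultimately have "x \<in> C"
        unfolding C_def by (intro image_eqI[where x="(s, x + s *\<^sub>R x)"]) simp_all
      with that(3) show False ..
    qed
    assume s: "0 < s"
    have m: "(\<lambda>x. w x * h x) \<in> borel_measurable borel"
      using w(1) borel_measurable_continuous_onI[OF lipschitz_on_continuous_on[OF L]] by simp
    have "(LINT x|lborel. w x * h x)
        = (LINT x|density (distr lborel borel (\<lambda>x. 0 + (1 + s) *\<^sub>R x)) (\<lambda>_. \<bar>1 + s\<bar> ^ DIM('a)). w x * h x)"
      using s by (subst lborel_affine[of "1 + s" 0]) auto
    also have "\<dots> = (LINT x|lborel. (1 + s) ^ DIM('a) * (w ((1 + s) *\<^sub>R x) * h ((1 + s) *\<^sub>R x)))"
      using m s by (simp add: integral_density integral_distr)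
    also have "\<dots> = (LINT x|lborel. w x * h (x + s *\<^sub>R x))"
      using wc[of "1 + s"] s unfolding e by simp
    finally show "(LINT x|lborel. w x * h (x + s *\<^sub>R x)) = (LINT x|lborel. w x * h x)" ..
  qed auto
qed

section \<open>Distributions represented by locally bounded Borel weights\<close>

lemma test_functions_derivative:
  assumes "\<phi> \<in> test_functions \<Omega>"
  shows "(\<lambda>x. frechet_derivative \<phi> (at x) v) \<in> test_functions \<Omega>"
proof -
  let ?S = "closure {x. \<phi> x \<noteq> 0}"
  have \<phi>: "C_k k \<phi>" "compact ?S" "?S \<subseteq> \<Omega>" for k
    using assms by (simp_all add: test_functions_def)
  have "{x. frechet_derivative \<phi> (at x) v \<noteq> 0} \<subseteq> ?S"
    using frechet_derivative_eq_0_outside_support[of _ \<phi> v] by force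
  then have S: "closure {x. frechet_derivative \<phi> (at x) v \<noteq> 0} \<subseteq> ?S"
    by (rule closure_minimal) simp
  have "compact (closure {x. frechet_derivative \<phi> (at x) v \<noteq> 0})"
    using bounded_subset[OF compact_imp_bounded[OF \<phi>(2)] S] by (simp add: compact_eq_bounded_closed)
  moreover have "C_k k (\<lambda>x. frechet_derivative \<phi> (at x) v)" for k
    using \<phi>(1)[of "Suc k"] by simp
  ultimately show ?thesis
    using S \<phi>(3) by (simp add: test_functions_def)
qed

text \<open>Boundedness is asked only on compact subsets of \<open>U\<close>, since weights such as
  \<open>1 / t\<close> blow up at \<open>t = 0\<close>. Borel measurability allows integration over
  \<open>lborel\<close>, where the change of variables under translations and dilations is carried
  out.\<close>

definition locally_bounded_borel :: "'a::euclidean_space set \<Rightarrow> ('a \<Rightarrow> real) \<Rightarrow> bool" where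
  "locally_bounded_borel U w \<longleftrightarrow>
     w \<in> borel_measurable borel \<and> (\<forall>K. compact K \<and> K \<subseteq> U \<longrightarrow> bounded (w ` K))"

lemma locally_bounded_borel_mult:
  assumes "locally_bounded_borel U f" "locally_bounded_borel U g"
  shows "locally_bounded_borel U (\<lambda>x. f x * g x)"
  unfolding locally_bounded_borel_def
proof (intro conjI allI impI)
  show "(\<lambda>x. f x * g x) \<in> borel_measurable borel"
    using assms unfolding locally_bounded_borel_def by (intro borel_measurable_times) auto
  fix K assume K: "compact K \<and> K \<subseteq> U"
  obtain A where A: "\<And>x. x \<in> K \<Longrightarrow> norm (f x) \<le> A"
    using assms(1) K unfolding locally_bounded_borel_def by (metis bounded_image_normE)
  obtain B where B: "\<And>x. x \<in> K \<Longrightarrow> norm (g x) \<le> B"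
    using assms(2) K unfolding locally_bounded_borel_def by (metis bounded_image_normE)
  have "norm (f x * g x) \<le> A * B" if "x \<in> K" for x
    unfolding norm_mult using A[OF that] B[OF that] norm_ge_zero[of "f x"]
    by (intro mult_mono) (auto simp del: norm_ge_zero real_norm_def intro: order_trans[OF norm_ge_zero])
  then show "bounded ((\<lambda>x. f x * g x) ` K)"
    by (intro boundedI[where B="A * B"]) auto
qed

text \<open>Extension by zero makes the weight total, so that it can be integrated over the whole
  space; its values off \<open>U\<close> never meet a compact subset of \<open>U\<close>.\<close>

lemma locally_bounded_borel_continuous:
  assumes "open U" "continuous_on U f"
  shows "locally_bounded_borel U (\<lambda>x. if x \<in> U then f x else 0)"
  unfolding locally_bounded_borel_def
proof (intro conjI allI impI)
  show "(\<lambda>x. if x \<in> U then f x else 0) \<in> borel_measurable borel"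
    using assms by (intro borel_measurable_continuous_on_if) auto
  fix K assume K: "compact K \<and> K \<subseteq> U"
  have "bounded (f ` K)"
    using K continuous_on_subset[OF assms(2)] by (intro compact_imp_bounded compact_continuous_image) auto
  moreover have "(\<lambda>x. if x \<in> U then f x else 0) ` K = f ` K"
    using K by (intro image_cong) auto
  ultimately show "bounded ((\<lambda>x. if x \<in> U then f x else 0) ` K)" by simp
qed

lemma locally_bounded_borel_integrable:
  assumes w: "locally_bounded_borel U w" and U: "\<Omega> \<subseteq> U" and \<phi>: "\<phi> \<in> test_functions \<Omega>"
  shows "integrable lborel (\<lambda>x. w x * \<phi> x)"
proof (rule integrable_bounded_times_compact_support)
  let ?S = "closure {x. \<phi> x \<noteq> 0}"
  show S: "compact ?S" using \<phi> by (simp add: test_functions_def)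
  have "?S \<subseteq> U" using \<phi> U by (auto simp: test_functions_def)
  then show "w \<in> borel_measurable borel" "bounded (w ` ?S)"
    using w S unfolding locally_bounded_borel_def by auto
  have "C_k 0 \<phi>" using \<phi> unfolding test_functions_def by blast
  then show "continuous_on UNIV \<phi>" by simp
  show "\<phi> x = 0" if "x \<notin> ?S" for x
    using that closure_subset[of "{x. \<phi> x \<noteq> 0}"] by auto
qed

text \<open>The density is prescribed only off the interfaces, so its measurability has to come from
  the Borel representative \<open>w\<close>; a change on a negligible set preserves absolute
  integrability.\<close>

lemma locally_integrable_locally_bounded_borel:
  assumes w: "locally_bounded_borel U w" and U: "\<Omega> \<subseteq> U"
    and N: "negligible N" "\<And>x. x \<in> \<Omega> \<Longrightarrow> x \<notin> N \<Longrightarrow> f x = w x"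
  shows "locally_integrable \<Omega> f"
  unfolding locally_integrable_def
proof (intro allI impI)
  fix K assume K: "compact K \<and> K \<subseteq> \<Omega>"
  have "bounded (w ` K)" and m: "w \<in> borel_measurable borel"
    using w K U unfolding locally_bounded_borel_def by auto
  then obtain A where A: "\<And>x. x \<in> K \<Longrightarrow> norm (w x) \<le> A"
    by (metis bounded_image_normE)
  have Kb: "K \<in> sets borel" "emeasure lborel K < \<infinity>"
    using K emeasure_bounded_finite[OF compact_imp_bounded, of K] by (auto intro: borel_compact)
  have "integrable lborel (\<lambda>x. indicator K x *\<^sub>R w x)"
  proof (rule Bochner_Integration.integrable_bound)
    show "integrable lborel (\<lambda>x. indicator K x * A)"
      using Kb by (intro integrable_mult_left integrable_real_indicator) simp_all
    show "(\<lambda>x. indicator K x *\<^sub>R w x) \<in> borel_measurable lborel"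
      using m Kb by simp
    show "AE x in lborel. norm (indicator K x *\<^sub>R w x) \<le> norm (indicator K x * A)"
      using A by (intro AE_I2) (auto simp: indicator_def intro: order_trans[OF _ abs_ge_self])
  qed
  then have "w absolutely_integrable_on K"
    using m Kb unfolding set_integrable_def by (subst integrable_completion) simp_all
  then show "f absolutely_integrable_on K"
    by (rule absolutely_integrable_spike[OF _ N(1)]) (use N(2) K in auto)
qed

text \<open>Replaces a function known only almost everywhere on \<open>\<Omega>\<close> by a global
  Borel weight. The restriction to \<open>\<Omega>\<close> disappears because \<open>\<phi>\<close>
  vanishes outside it.\<close>

lemma dist_of_eq_lborel_integral:
  assumes w: "locally_bounded_borel U w" and U: "\<Omega> \<subseteq> U"
    and N: "negligible N" "\<And>x. x \<in> \<Omega> \<Longrightarrow> x \<notin> N \<Longrightarrow> f x = w x"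
    and \<phi>: "\<phi> \<in> test_functions \<Omega>"
  shows "dist_of \<Omega> f \<phi> = (LINT x|lborel. w x * \<phi> x)"
proof -
  let ?f = "\<lambda>x. indicator \<Omega> x *\<^sub>R (f x * \<phi> x)"
  let ?g = "\<lambda>x. w x * \<phi> x"
  have "{x. \<phi> x \<noteq> 0} \<subseteq> \<Omega>"
    using \<phi> closure_subset[of "{x. \<phi> x \<noteq> 0}"] by (auto simp: test_functions_def)
  then have eq: "?f x = ?g x" if "x \<notin> N" for x
    using N(2) that by (cases "x \<in> \<Omega>") auto
  have i: "integrable lborel ?g"
    by (rule locally_bounded_borel_integrable[OF w U \<phi>])
  then have m: "?g \<in> borel_measurable lborel" by (rule borel_measurable_integrable)
  have g: "integrable lebesgue ?g"
    using i by (subst integrable_completion[OF m])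
  then have "?g absolutely_integrable_on UNIV" by (simp add: set_integrable_def)
  then have "?f absolutely_integrable_on UNIV"
    by (rule absolutely_integrable_spike[OF _ N(1)]) (use eq in auto)
  then have f: "integrable lebesgue ?f" by (simp add: set_integrable_def)
  \<comment> \<open>The detour through the gauge integral \<open>integral UNIV\<close> allows the
    negligible set \<open>N\<close> to be discarded by \<open>integral_spike\<close>.\<close>
  have "dist_of \<Omega> f \<phi> = integral UNIV ?f"
    unfolding dist_of_def set_lebesgue_integral_def by (rule integral_lebesgue[OF f, symmetric])
  also have "\<dots> = integral UNIV ?g"
    by (rule integral_spike[OF N(1)], rule eq[symmetric]) simp
  also have "\<dots> = (LINT x|lebesgue. ?g x)" by (rule integral_lebesgue[OF g])
  also have "\<dots> = (LINT x|lborel. ?g x)" by (rule integral_completion[OF m])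
  finally show ?thesis .
qed

section \<open>Null interfaces and vanishing integrals in space-time\<close>

lemma negligible_expanding_sphere:
  fixes c :: real
  shows "negligible {x :: real \<times> (real^'d::finite). 1 \<le> fst x \<and> norm (snd x) = c * fst x}"
    (is "negligible ?S")
proof (cases "c = 0")
  case True
  \<comment> \<open>This merely names some spatial index: for \<open>c = 0\<close> the set lies in
    the axis \<open>y = 0\<close>, hence in the hyperplane where coordinate \<open>i\<close>
    vanishes.\<close>
  obtain i :: 'd where True by simp
  have "?S \<subseteq> {x. (0, axis i 1) \<bullet> x = 0}"
    using True by (auto simp: inner_prod_def)
  moreover have "negligible {x :: real \<times> (real^'d). (0, axis i 1) \<bullet> x = 0}"
    by (rule negligible_hyperplane) (simp add: zero_prod_def axis_eq_0_iff)
  ultimately show ?thesis by (rule negligible_subset[rotated])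
next
  case False
  \<comment> \<open>The set contains rays from the origin, hence the base point \<open>(-1, 0)\<close> for the star shape.\<close>
  show ?thesis
  proof (rule starlike_negligible[where a="(-1, 0)"])
    show "closed ?S"
      by (intro closed_Collect_conj closed_Collect_le closed_Collect_eq continuous_intros)
    fix r :: real and x :: "real \<times> (real^'d)"
    assume r: "(-1, 0) + r *\<^sub>R x \<in> ?S" "0 \<le> r" "(-1, 0) + x \<in> ?S"
    \<comment> \<open>Membership written out after undoing the shift by \<open>(-1, 0)\<close>;
      \<open>0 \<le> r\<close> lets \<open>r\<close> leave the norm. Comparing the two equations
      cancels the terms in \<open>fst x\<close> and leaves \<open>c * r = c\<close>.\<close>
    have "r * norm (snd x) = c * (r * fst x - 1)" "norm (snd x) = c * (fst x - 1)"
      using r by auto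
    then have "r * (c * (fst x - 1)) = c * (r * fst x - 1)" by simp
    then have "c * r = c" by (simp add: algebra_simps)
    then show "r = 1" using False by simp
  qed
qed

text \<open>Prepares an integration by parts against the velocity, in which the factor
  \<open>y_k\<close> is absorbed into the test function. C^1 is the regularity that the translation
  identity asks for.\<close>

lemma C1_coordinate_mult:
  fixes \<psi> :: "real \<times> (real^'d::finite) \<Rightarrow> real"
  assumes "C_k (Suc 0) \<psi>"
  shows "C_k (Suc 0) (\<lambda>x. snd x $ k * \<psi> x)"
    and "frechet_derivative (\<lambda>x. snd x $ k * \<psi> x) (at x) v
      = snd v $ k * \<psi> x + snd x $ k * frechet_derivative \<psi> (at x) v"
proof -
  have \<psi>: "\<psi> differentiable at x" "continuous_on UNIV (\<lambda>x. frechet_derivative \<psi> (at x) v)" for x v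
    using assms unfolding C_k.simps by blast+
  have c: "continuous_on UNIV \<psi>"
    using \<psi>(1) by (intro differentiable_imp_continuous_on) (auto simp: differentiable_on_def intro: differentiable_at_withinI)
  have D: "((\<lambda>x. snd x $ k * \<psi> x) has_derivative
      (\<lambda>v. snd v $ k * \<psi> x + snd x $ k * frechet_derivative \<psi> (at x) v)) (at x)" for x
  proof -
    have "((\<lambda>x :: real \<times> (real^'d). snd x $ k) has_derivative (\<lambda>v. snd v $ k)) (at x)"
      by (intro bounded_linear_imp_has_derivative bounded_linear_compose[OF bounded_linear_vec_nth bounded_linear_snd])
    moreover have "(\<psi> has_derivative frechet_derivative \<psi> (at x)) (at x)"
      using \<psi>(1) frechet_derivative_works by blast
    ultimately show ?thesis
      by (rule has_derivative_eq_rhs[OF has_derivative_mult]) (auto simp: fun_eq_iff)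
  qed
  show e: "frechet_derivative (\<lambda>x. snd x $ k * \<psi> x) (at x) v
      = snd v $ k * \<psi> x + snd x $ k * frechet_derivative \<psi> (at x) v" for x v
    using frechet_derivative_at[OF D] by (metis (lifting))
  show "C_k (Suc 0) (\<lambda>x. snd x $ k * \<psi> x)"
    unfolding C_k.simps e
  proof (intro conjI allI)
    show "(\<lambda>x. snd x $ k * \<psi> x) differentiable at x" for x
      using D by (rule differentiableI)
    show "continuous_on UNIV (\<lambda>x. snd v $ k * \<psi> x + snd x $ k * frechet_derivative \<psi> (at x) v)" for v
      by (intro continuous_intros c \<psi>(2))
  qed
qed

text \<open>A weight depending on time alone is invariant under spatial translations. This applies
  to the pressure and to \<open>1 / t\<close>.\<close>

lemma integral_spatial_derivative_eq_0:
  fixes w :: "real \<times> (real^'d::finite) \<Rightarrow> real"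
  assumes w: "locally_bounded_borel ({0<..} \<times> UNIV) w"
    and inv: "\<And>t y z. w (t, y) = w (t, z)"
    and h: "C_k (Suc 0) h" "compact (closure {x. h x \<noteq> 0})"
      "closure {x. h x \<noteq> 0} \<subseteq> {0<..} \<times> UNIV"
  shows "(LINT x|lborel. w x * frechet_derivative h (at x) (0, e)) = 0"
proof (rule integral_translation_derivative_eq_0[OF h])
  show "w (x + s *\<^sub>R (0, e)) = w x" for x s
    using inv by (cases x) simp
qed (use w in \<open>auto simp: locally_bounded_borel_def\<close>)

text \<open>With \<open>\<psi>\<close> the derivative of \<open>\<phi>\<close> along
  \<open>f\<close>, the product rule gives
  \<open>(y_k / t) D_e \<psi> = D_e (y_k \<psi>) / t - e_k \<psi> / t\<close>. Both terms on the
  right are spatial derivatives weighted by \<open>1 / t\<close>, the last one because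
  \<open>\<psi>\<close> is itself such a derivative. This is the weak form of the fact that the
  gradient of \<open>y / t\<close> depends on time only.\<close>

lemma integral_velocity_second_derivative_eq_0:
  fixes \<phi> :: "real \<times> (real^'d::finite) \<Rightarrow> real"
  assumes \<phi>: "\<phi> \<in> test_functions \<Omega>" and U: "\<Omega> \<subseteq> {0<..} \<times> UNIV"
  shows "(LINT x|lborel. (if x \<in> {0<..} \<times> UNIV then snd x $ k / fst x else 0) *
    frechet_derivative (\<lambda>x. frechet_derivative \<phi> (at x) (0, f)) (at x) (0, e)) = 0"
proof -
  define \<tau> :: "real \<times> (real^'d) \<Rightarrow> real"
    where "\<tau> x = (if x \<in> {0<..} \<times> UNIV then 1 / fst x else 0)" for x
  have \<tau>: "locally_bounded_borel ({0<..} \<times> UNIV) \<tau>"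
    unfolding \<tau>_def
    by (intro locally_bounded_borel_continuous open_Times) (auto intro!: continuous_intros)
  have \<tau>inv: "\<tau> (t, y) = \<tau> (t, z)" for t y z by (simp add: \<tau>_def)
  define \<psi> where "\<psi> x = frechet_derivative \<phi> (at x) (0, f)" for x
  have T: "\<psi> \<in> test_functions \<Omega>"
    unfolding \<psi>_def by (rule test_functions_derivative[OF \<phi>])
  have test: "C_k n g" "compact (closure {x. g x \<noteq> 0})" "closure {x. g x \<noteq> 0} \<subseteq> {0<..} \<times> UNIV"
    if "g \<in> test_functions \<Omega>" for g n
    using that U by (auto simp: test_functions_def)
  have \<tau>\<psi>: "(LINT x|lborel. \<tau> x * \<psi> x) = 0"
    unfolding \<psi>_def by (rule integral_spatial_derivative_eq_0[OF \<tau> \<tau>inv test[OF \<phi>]])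
  let ?h = "\<lambda>x. snd x $ k * \<psi> x"
  have "{x. ?h x \<noteq> 0} \<subseteq> {x. \<psi> x \<noteq> 0}" by auto
  then have S: "closure {x. ?h x \<noteq> 0} \<subseteq> closure {x. \<psi> x \<noteq> 0}" by (rule closure_mono)
  have "compact (closure {x. ?h x \<noteq> 0})"
    using bounded_subset[OF compact_imp_bounded[OF test(2)[OF T]] S] by (simp add: compact_eq_bounded_closed)
  then have "(LINT x|lborel. \<tau> x * frechet_derivative ?h (at x) (0, e)) = 0"
    by (intro integral_spatial_derivative_eq_0[OF \<tau> \<tau>inv] C1_coordinate_mult(1)[OF test(1)[OF T]]
        order_trans[OF S test(3)[OF T]])
  moreover have "(LINT x|lborel. \<tau> x * frechet_derivative ?h (at x) (0, e))
      = (LINT x|lborel. e $ k * (\<tau> x * \<psi> x)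
          + (if x \<in> {0<..} \<times> UNIV then snd x $ k / fst x else 0) * frechet_derivative \<psi> (at x) (0, e))"
    unfolding C1_coordinate_mult(2)[OF test(1)[OF T]]
    by (intro Bochner_Integration.integral_cong) (auto simp: \<tau>_def field_simps)
  moreover have "\<dots> = e $ k * (LINT x|lborel. \<tau> x * \<psi> x)
      + (LINT x|lborel. (if x \<in> {0<..} \<times> UNIV then snd x $ k / fst x else 0) * frechet_derivative \<psi> (at x) (0, e))"
  proof (subst Bochner_Integration.integral_add)
    show "integrable lborel (\<lambda>x. e $ k * (\<tau> x * \<psi> x))"
      by (intro integrable_mult_right locally_bounded_borel_integrable[OF \<tau> U T])
    have "locally_bounded_borel ({0<..} \<times> UNIV)
        (\<lambda>x :: real \<times> (real^'d). if x \<in> {0<..} \<times> UNIV then snd x $ k / fst x else 0)"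
      by (intro locally_bounded_borel_continuous open_Times) (auto intro!: continuous_intros)
    then show "integrable lborel (\<lambda>x. (if x \<in> {0<..} \<times> UNIV then snd x $ k / fst x else 0)
        * frechet_derivative \<psi> (at x) (0, e))"
      by (rule locally_bounded_borel_integrable[OF _ U test_functions_derivative[OF T]])
  qed simp
  ultimately show ?thesis
    using \<tau>\<psi> unfolding \<psi>_def by simp
qed

text \<open>Stated for a general weight of degree \<open>-d\<close> so that it serves both
  equations: the mass equation with the density as weight, the momentum equation with the density
  times a velocity component.\<close>

lemma integral_material_derivative_eq_0:
  fixes R \<phi> :: "real \<times> (real^'d::finite) \<Rightarrow> real"
  assumes R: "locally_bounded_borel ({0<..} \<times> UNIV) R"
    and hom: "\<And>c x. 0 < c \<Longrightarrow> R (c *\<^sub>R x) = R x / c ^ CARD('d)"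
    and \<phi>: "\<phi> \<in> test_functions \<Omega>" and U: "\<Omega> \<subseteq> {0<..} \<times> UNIV"
  shows "(LINT x|lborel. R x * frechet_derivative \<phi> (at x) (1, 0))
    + (\<Sum>j\<in>UNIV. LINT x|lborel. (R x * (if x \<in> {0<..} \<times> UNIV then snd x $ j / fst x else 0))
        * frechet_derivative \<phi> (at x) (0, axis j 1)) = 0"
proof -
  let ?U = "{0<..} \<times> UNIV :: (real \<times> (real^'d)) set"
  define \<tau> :: "real \<times> (real^'d) \<Rightarrow> real" where "\<tau> x = (if x \<in> ?U then 1 / fst x else 0)" for x
  define v where "v j x = (if x \<in> ?U then snd x $ j / fst x else 0)" for j and x :: "real \<times> (real^'d)"
  let ?D = "\<lambda>x. frechet_derivative \<phi> (at x)"
  have \<tau>: "locally_bounded_borel ?U \<tau>"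
    unfolding \<tau>_def
    by (intro locally_bounded_borel_continuous open_Times) (auto intro!: continuous_intros)
  have v: "locally_bounded_borel ?U (v j)" for j
    unfolding v_def
    by (intro locally_bounded_borel_continuous open_Times) (auto intro!: continuous_intros)
  have S: "C_k n \<phi>" "compact (closure {x. \<phi> x \<noteq> 0})" "closure {x. \<phi> x \<noteq> 0} \<subseteq> ?U" for n
    using \<phi> U by (auto simp: test_functions_def)
  have "(LINT x|lborel. (R x * \<tau> x) * ?D x x) = 0"
  proof (rule integral_euler_derivative_eq_0[OF S])
    have "locally_bounded_borel ?U (\<lambda>x. R x * \<tau> x)"
      by (rule locally_bounded_borel_mult[OF R \<tau>])
    then show "(\<lambda>x. R x * \<tau> x) \<in> borel_measurable borel"
      "\<And>K. compact K \<Longrightarrow> K \<subseteq> ?U \<Longrightarrow> bounded ((\<lambda>x. R x * \<tau> x) ` K)"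
      by (auto simp: locally_bounded_borel_def)
    \<comment> \<open>Space-time has dimension \<open>d + 1\<close>: \<open>hom\<close> supplies
      \<open>d\<close> powers of \<open>c\<close>, and \<open>\<tau>\<close> supplies the remaining
      one.\<close>
    show "R (c *\<^sub>R x) * \<tau> (c *\<^sub>R x) = R x * \<tau> x / c ^ DIM(real \<times> (real^'d))" if "0 < c" for x c
      using that hom[OF that] by (auto simp: \<tau>_def mem_Times_iff zero_less_mult_iff)
    show "c *\<^sub>R x \<in> ?U" if "0 < c" "x \<in> ?U" for x c
      using that by (auto simp: mem_Times_iff)
  qed
  \<comment> \<open>Expanding \<open>x\<close> in the standard basis turns the Euler derivative
    divided by \<open>t\<close> into the transport operator. Off \<open>?U\<close> both sides are
    zero, because every derivative of \<open>\<phi>\<close> vanishes off its support.\<close>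
  moreover have "(R x * \<tau> x) * ?D x x = R x * ?D x (1, 0) + (\<Sum>j\<in>UNIV. (R x * v j x) * ?D x (0, axis j 1))" for x
  proof (cases "x \<in> ?U")
    case True
    have lin: "linear (?D x)"
      using S(1)[of "Suc 0"] unfolding C_k.simps by (intro linear_frechet_derivative) blast
    have "x = fst x *\<^sub>R (1, 0) + (\<Sum>j\<in>UNIV. (snd x $ j) *\<^sub>R (0, axis j 1))"
      using basis_expansion[of "snd x"]
      by (simp add: prod_eq_iff fst_sum snd_sum scalar_mult_eq_scaleR)
    then have "?D x x = ?D x (fst x *\<^sub>R (1, 0) + (\<Sum>j\<in>UNIV. (snd x $ j) *\<^sub>R (0, axis j 1)))"
      by (rule arg_cong)
    also have "\<dots> = fst x * ?D x (1, 0) + (\<Sum>j\<in>UNIV. (snd x $ j) * ?D x (0, axis j 1))"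
      unfolding linear_add[OF lin] linear_sum[OF lin] linear_cmul[OF lin] real_scaleR_def ..
    finally have e: "?D x x = fst x * ?D x (1, 0) + (\<Sum>j\<in>UNIV. (snd x $ j) * ?D x (0, axis j 1))" .
    show ?thesis
      unfolding e using True
      by (auto simp: \<tau>_def v_def mem_Times_iff distrib_left sum_distrib_left field_simps)
  next
    case False
    then have "x \<notin> closure {x. \<phi> x \<noteq> 0}" using S(3) by blast
    then have "?D x z = 0" for z by (rule frechet_derivative_eq_0_outside_support)
    then show ?thesis by simp
  qed
  ultimately have "(LINT x|lborel. R x * ?D x (1, 0) + (\<Sum>j\<in>UNIV. (R x * v j x) * ?D x (0, axis j 1))) = 0"
    by simp
  moreover have "integrable lborel (\<lambda>x. R x * ?D x (1, 0))"
    by (rule locally_bounded_borel_integrable[OF R U test_functions_derivative[OF \<phi>]])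
  moreover have "integrable lborel (\<lambda>x. (R x * v j x) * ?D x (0, axis j 1))" for j
    by (rule locally_bounded_borel_integrable[OF locally_bounded_borel_mult[OF R v] U test_functions_derivative[OF \<phi>]])
  ultimately show ?thesis
    unfolding v_def[symmetric] by (simp add: Bochner_Integration.integral_sum)
qed

section \<open>The self-similar solution with oscillating density\<close>

theorem proposition2p1:
  fixes \<theta> \<mu> lam a b :: real
    and p :: "real \<Rightarrow> real"
    and \<rho> :: "real \<times> (real^'d) \<Rightarrow> real"
    and u :: "real \<times> (real^'d) \<Rightarrow> real^'d"
  assumes "0 < \<theta>" "\<theta> < 1"
    and "\<mu> > 0" "lam + \<mu> > 0"
    and "0 < a / 2 ^ CARD('d)" "a / 2 ^ CARD('d) < a"
      "a < b / 2 ^ CARD('d)" "b / 2 ^ CARD('d) < b"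
    and "continuous_on {0<..} p"
    and "\<And>t. t \<in> {1..2} \<Longrightarrow> p (a / t ^ CARD('d)) = p (b / t ^ CARD('d))"
    and "\<And>t y (k::nat). t \<in> {1..2} \<Longrightarrow> real k * t < norm y \<Longrightarrow> norm y < (real k + \<theta>) * t
           \<Longrightarrow> \<rho> (t, y) = a / t ^ CARD('d)"
    and "\<And>t y (k::nat). t \<in> {1..2} \<Longrightarrow> (real k + \<theta>) * t < norm y \<Longrightarrow> norm y < (real k + 1) * t
           \<Longrightarrow> \<rho> (t, y) = b / t ^ CARD('d)"
    and "\<And>t y. t \<in> {1..2} \<Longrightarrow> u (t, y) = y /\<^sub>R t"
  shows "weak_solution_NS ({1<..<2} \<times> UNIV) \<mu> lam p \<rho> u"
proof -
  let ?d = "CARD('d)"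
  let ?U = "{0<..} \<times> UNIV :: (real \<times> (real^'d)) set"
  let ?\<Omega> = "{1<..<2} \<times> UNIV :: (real \<times> (real^'d)) set"
  have ab: "0 < a" "0 < b"
    using assms(5-8) by (simp_all add: zero_less_divide_iff)
  have U: "?\<Omega> \<subseteq> ?U" by auto
  \<comment> \<open>The integer part of \<open>|y| / t\<close> is the shell number and its
    fractional part selects the layer, so one formula covers all \<open>k\<close>. It depends on
    \<open>y / t\<close> only and is thus unchanged by positive dilations.\<close>
  define G where "G x = (if frac (norm (snd x) / fst x) < \<theta> then a else b)" for x :: "real \<times> (real^'d)"
  define R where "R x = G x * (if x \<in> ?U then 1 / fst x ^ ?d else 0)" for x
  define v where "v i x = (if x \<in> ?U then snd x $ i / fst x else 0)" for i x
  \<comment> \<open>Only the branch with \<open>a\<close> is used: on \<open>?\<Omega>\<close> the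
    layers with \<open>b\<close> have the same pressure by assumption, which makes the pressure a
    function of time alone.\<close>
  define q where "q x = (if x \<in> ?U then p (a / fst x ^ ?d) else 0)" for x
  have "locally_bounded_borel ?U G"
    unfolding locally_bounded_borel_def
  proof (intro conjI allI impI)
    show "G \<in> borel_measurable borel"
    proof -
      have m: "(\<lambda>x. norm (snd x) / fst x) \<in> borel_measurable (borel :: (real \<times> (real^'d)) measure)"
        by (intro borel_measurable_divide borel_measurable_continuous_onI continuous_intros)
      have [measurable]: "(\<lambda>x. frac (norm (snd x) / fst x)) \<in> borel_measurable (borel :: (real \<times> (real^'d)) measure)"
        unfolding frac_def by (intro borel_measurable_diff m measurable_compose[OF m borel_measurable_real_floor])
      show ?thesis unfolding G_def by measurable
    qed
    show "bounded (G ` K)" for K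
      by (rule bounded_subset[of "{a, b}"]) (auto simp: G_def)
  qed
  moreover have "locally_bounded_borel ?U (\<lambda>x. if x \<in> ?U then 1 / fst x ^ ?d else 0)"
    by (intro locally_bounded_borel_continuous open_Times) (auto intro!: continuous_intros)
  ultimately have R: "locally_bounded_borel ?U R"
    unfolding R_def by (rule locally_bounded_borel_mult)
  have v: "locally_bounded_borel ?U (v i)" for i
    unfolding v_def by (intro locally_bounded_borel_continuous open_Times) (auto intro!: continuous_intros)
  have q: "locally_bounded_borel ?U q"
    unfolding q_def using ab
    by (intro locally_bounded_borel_continuous open_Times continuous_on_compose2[OF assms(9)])
      (auto intro!: continuous_intros)
  have Rv: "locally_bounded_borel ?U (\<lambda>x. R x * v i x)" for i
    by (rule locally_bounded_borel_mult[OF R v])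
  have Rvv: "locally_bounded_borel ?U (\<lambda>x. R x * v i x * v j x)" for i j
    by (rule locally_bounded_borel_mult[OF Rv v])
  define S where "S c = {x :: real \<times> (real^'d). 1 \<le> fst x \<and> norm (snd x) = c * fst x}" for c
  \<comment> \<open>Both families of interfaces; the term \<open>k = 0\<close> of the first is the
    axis \<open>y = 0\<close>, where the density is not prescribed either.\<close>
  define N where "N = (\<Union>k. S (real k)) \<union> (\<Union>k. S (real k + \<theta>))"
  have N: "negligible N"
    unfolding N_def S_def
    by (intro negligible_Un negligible_countable_Union[of "range _"] countable_image)
      (auto intro!: negligible_expanding_sphere)
  have shells: "\<rho> x = R x \<and> p (\<rho> x) = q x \<and> 0 < \<rho> x" if x: "x \<in> ?\<Omega>" "x \<notin> N" for x
  proof -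
    obtain t y where xt: "x = (t, y)" by (cases x)
    have t: "1 < t" "t < 2" "t \<in> {1..2}" using x(1) xt by auto
    define k where "k = nat \<lfloor>norm y / t\<rfloor>"
    have "0 \<le> norm y / t" using t by simp
    then have k: "real k = of_int \<lfloor>norm y / t\<rfloor>" by (simp add: k_def)
    have "x \<notin> S (real k)" "x \<notin> S (real k + \<theta>)" using x(2) by (auto simp: N_def)
    \<comment> \<open>Avoiding the interfaces upgrades the weak inequality from the floor to a
      strict one, and later makes the two layers exhaust the shell.\<close>
    then have ne: "norm y \<noteq> real k * t" "norm y \<noteq> (real k + \<theta>) * t"
      using t by (auto simp: S_def xt)
    have "real k \<le> norm y / t" "norm y / t < real k + 1" unfolding k by linarith+
    then have lo: "real k * t < norm y" and hi: "norm y < (real k + 1) * t"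
      using t ne(1) by (auto simp: field_simps)
    have fr: "frac (norm y / t) = norm y / t - real k" by (simp add: frac_def k)
    have xU: "x \<in> ?U" using t xt by auto
    show ?thesis
    proof (cases "norm y < (real k + \<theta>) * t")
      case True
      then have \<rho>: "\<rho> x = a / t ^ ?d" unfolding xt using t lo by (intro assms(11))
      have "G x = a" using True t by (simp add: G_def xt fr field_simps)
      then show ?thesis using \<rho> ab t xU by (simp add: R_def q_def xt)
    next
      case False
      then have "(real k + \<theta>) * t < norm y" using ne by simp
      then have \<rho>: "\<rho> x = b / t ^ ?d" unfolding xt using t hi by (intro assms(12))
      have "G x = b" using False t by (simp add: G_def xt fr field_simps)
      then show ?thesis using \<rho> ab t xU assms(10)[OF t(3)] by (simp add: R_def q_def xt)
    qed
  qed
  have u: "u x $ i = v i x" if "x \<in> ?\<Omega>" for x i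
    using that assms(13) by (cases x) (auto simp: v_def divide_inverse mult.commute)
  have p_eq: "p (\<rho> x) = q x" if "x \<in> ?\<Omega>" "x \<notin> N" for x
    using shells[OF that] by blast
  have \<rho>_eq: "\<rho> x = R x" "\<rho> x * u x $ i = R x * v i x"
    "\<rho> x * u x $ i * u x $ j = R x * v i x * v j x" if "x \<in> ?\<Omega>" "x \<notin> N" for x i j
    using shells[OF that] u[OF that(1)] by simp_all
  note dist = dist_of_eq_lborel_integral[OF _ U N _ test_functions_derivative]
  have homR: "R (c *\<^sub>R x) = R x / c ^ ?d" and homv: "v i (c *\<^sub>R x) = v i x" if "0 < c" for c x i
    using that by (auto simp: R_def G_def v_def mem_Times_iff zero_less_mult_iff power_mult_distrib)
  \<comment> \<open>In the viscous term two derivatives fall on the test function: \<open>f\<close>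
    is the direction from the outer divergence, \<open>e\<close> the one from the velocity
    gradient.\<close>
  have second: "dist_of ?\<Omega> (\<lambda>x. u x $ k)
      (\<lambda>x. frechet_derivative (\<lambda>x. frechet_derivative \<phi> (at x) (0, f)) (at x) (0, e)) = 0"
    if "\<phi> \<in> test_functions ?\<Omega>" for \<phi> k e f
    using dist[OF v u test_functions_derivative[OF that]]
      integral_velocity_second_derivative_eq_0[OF that U, folded v_def] by simp
  show ?thesis
    unfolding weak_solution_NS_def
  proof (intro conjI allI ballI)
    have "AE x in lebesgue. x \<notin> N"
      using N by (intro AE_not_in) (simp add: negligible_iff_null_sets)
    then show "AE x in lebesgue. x \<in> ?\<Omega> \<longrightarrow> 0 < \<rho> x"
      by (rule eventually_mono) (use shells in blast)
    show "locally_integrable ?\<Omega> \<rho>"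
      by (rule locally_integrable_locally_bounded_borel[OF R U N \<rho>_eq(1)])
    show "locally_integrable ?\<Omega> (\<lambda>x. p (\<rho> x))"
      by (rule locally_integrable_locally_bounded_borel[OF q U N p_eq])
    show "locally_integrable ?\<Omega> (\<lambda>x. u x $ i)" for i
      by (rule locally_integrable_locally_bounded_borel[OF v U N u])
    show "locally_integrable ?\<Omega> (\<lambda>x. \<rho> x * u x $ i)" for i
      by (rule locally_integrable_locally_bounded_borel[OF Rv U N \<rho>_eq(2)])
    show "locally_integrable ?\<Omega> (\<lambda>x. \<rho> x * u x $ i * u x $ j)" for i j
      by (rule locally_integrable_locally_bounded_borel[OF Rvv U N \<rho>_eq(3)])
    fix \<phi> assume \<phi>: "\<phi> \<in> test_functions ?\<Omega>"
    let ?D = "\<lambda>x. frechet_derivative \<phi> (at x)"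
    have dist_\<rho>: "dist_of ?\<Omega> \<rho> (\<lambda>x. ?D x z) = (LINT x|lborel. R x * ?D x z)" for z
      by (rule dist[OF R \<rho>_eq(1) \<phi>])
    have dist_p: "dist_of ?\<Omega> (\<lambda>x. p (\<rho> x)) (\<lambda>x. ?D x z) = (LINT x|lborel. q x * ?D x z)" for z
      by (rule dist[OF q p_eq \<phi>])
    have dist_\<rho>u: "dist_of ?\<Omega> (\<lambda>x. \<rho> x * u x $ i) (\<lambda>x. ?D x z)
        = (LINT x|lborel. R x * v i x * ?D x z)" for i z
      by (rule dist[OF Rv \<rho>_eq(2) \<phi>])
    have dist_\<rho>uu: "dist_of ?\<Omega> (\<lambda>x. \<rho> x * u x $ i * u x $ j) (\<lambda>x. ?D x z)
        = (LINT x|lborel. R x * v i x * v j x * ?D x z)" for i j z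
      by (rule dist[OF Rvv \<rho>_eq(3) \<phi>])
    show "dt (dist_of ?\<Omega> \<rho>) \<phi> + dist_div (\<lambda>j. dist_of ?\<Omega> (\<lambda>x. \<rho> x * u x $ j)) \<phi> = 0"
      using integral_material_derivative_eq_0[OF R homR \<phi> U, folded v_def]
      unfolding dt_def dist_div_def dx_def dist_deriv_def
      unfolding dist_\<rho> dist_\<rho>u
      by (simp add: sum_negf)
    fix i
    \<comment> \<open>The velocity components have degree 0, so the momentum weight
      \<open>R x * v i x\<close> keeps degree \<open>-d\<close> and the transport identity applies
      to it as well.\<close>
    have hom: "R (c *\<^sub>R x) * v i (c *\<^sub>R x) = R x * v i x / c ^ ?d" if "0 < c" for c x
      by (simp add: homR[OF that] homv[OF that])
    have "(LINT x|lborel. q x * frechet_derivative \<phi> (at x) (0, axis i 1)) = 0"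
    proof (rule integral_spatial_derivative_eq_0[OF q])
      show "q (t, y) = q (t, z)" for t y z by (simp add: q_def)
    qed (use \<phi> U in \<open>auto simp: test_functions_def simp del: C_k.simps\<close>)
    moreover have stress: "dist_div (viscous_stress ?\<Omega> \<mu> lam u i) \<phi> = 0"
      unfolding dist_div_def viscous_stress_def dx_def dist_deriv_def second[OF \<phi>] by simp
    ultimately show "dt (dist_of ?\<Omega> (\<lambda>x. \<rho> x * u x $ i)) \<phi>
        + dist_div (\<lambda>j. dist_of ?\<Omega> (\<lambda>x. \<rho> x * u x $ i * u x $ j)) \<phi>
        + dx i (dist_of ?\<Omega> (\<lambda>x. p (\<rho> x))) \<phi>
        = dist_div (viscous_stress ?\<Omega> \<mu> lam u i) \<phi>"
      using integral_material_derivative_eq_0[OF Rv hom \<phi> U, folded v_def]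
      unfolding stress
      unfolding dt_def dist_div_def dx_def dist_deriv_def
      unfolding dist_\<rho>u dist_\<rho>uu dist_p
      by (simp add: sum_negf)
  qed
qed

end
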